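(* Let $p$ be a prime, let $\mathcal H$ be a finite hypergraph, and let $G$ be a finite $p$-group acting on $\mathcal H$. Then $$\chi(\Theta(\mathcal H))\equiv \chi(\Theta(\mathcal H/G)) \mod p.$$
   Context: A hypergraph $\mathcal H=(V,H)$ is a nonempty set $V$ of vertices with a collection $H$ of subsets of $V$, called hyperedges. $\Theta(\mathcal H)$ is the simplicial complex whose simplices are the (nonempty) finite subsets of complements $V\setminus h$ of hyperedges $h\in H$. A group $G$ acts on $\mathcal H$ if it acts on $V$ and carries hyperedges to hyperedges. The quotient hypergraph $\mathcal H/G$ has vertex set $V/G$ (the set of orbits), and its hyperedges are the images of the hyperedges of $\mathcal H$ under the quotient map $V\to V/G$. $\chi$ denotes the (unreduced) Euler characteristic, so $\chi(\emptyset)=0$. *)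

theory Defs
  imports "HOL-Algebra.Group_Action" "HOL-Number_Theory.Cong"
begin

record 'v pre_hypergraph =
  verts :: "'v set"
  hyperedges :: "'v set set"

locale hypergraph =
  fixes X :: "'v pre_hypergraph"
  assumes verts_nonempty: "verts X \<noteq> {}"
    and hyperedge_subset: "h \<in> hyperedges X \<Longrightarrow> h \<subseteq> verts X"

locale hypergraph_action = hypergraph X + group_action G "verts X" \<phi>
  for X :: "'v pre_hypergraph" and G :: "('g, 'r) monoid_scheme" (structure)
    and \<phi> :: "'g \<Rightarrow> 'v \<Rightarrow> 'v" +
  assumes hyperedge_image:
    "\<lbrakk>g \<in> carrier G; h \<in> hyperedges X\<rbrakk> \<Longrightarrow> \<phi> g ` h \<in> hyperedges X"

definition Theta :: "'v pre_hypergraph \<Rightarrow> 'v set set" where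
  "Theta X = {\<sigma>. \<sigma> \<noteq> {} \<and> finite \<sigma> \<and> (\<exists>h \<in> hyperedges X. \<sigma> \<subseteq> verts X - h)}"

text \<open>On \<open>verts X\<close> the quotient map onto the set of orbits is \<open>orbit G \<phi>\<close>.\<close>

definition quotient_hypergraph ::
    "'v pre_hypergraph \<Rightarrow> ('g, 'r) monoid_scheme \<Rightarrow> ('g \<Rightarrow> 'v \<Rightarrow> 'v) \<Rightarrow> 'v set pre_hypergraph" where
  "quotient_hypergraph X G \<phi> =
     \<lparr>verts = orbits G (verts X) \<phi>, hyperedges = (\<lambda>h. orbit G \<phi> ` h) ` hyperedges X\<rparr>"

text \<open>The unreduced Euler characteristic of a finite complex, given as its set of nonempty
  simplices (the empty simplex is not a member); \<open>card \<sigma> - 1\<close> is the dimension of \<open>\<sigma>\<close>.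
  The value is meaningful only for finite \<open>K\<close>.\<close>

definition euler_char :: "'v set set \<Rightarrow> int" where
  "euler_char K = (\<Sum>\<sigma>\<in>K. (- 1) ^ (card \<sigma> - 1))"

lemma finite_Theta: "finite (verts X) \<Longrightarrow> finite (Theta X)"
  by (rule finite_subset[of _ "Pow (verts X)"]) (auto simp: Theta_def)

lemma (in hypergraph_action) hypergraph_quotient: "hypergraph (quotient_hypergraph X G \<phi>)"
proof
  show "verts (quotient_hypergraph X G \<phi>) \<noteq> {}"
    using verts_nonempty by (auto simp: quotient_hypergraph_def orbits_def)
  show "h \<subseteq> verts (quotient_hypergraph X G \<phi>)"
    if "h \<in> hyperedges (quotient_hypergraph X G \<phi>)" for h
    using that hyperedge_subset by (fastforce simp: quotient_hypergraph_def orbits_def)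
qed

end

theory Submission
  imports Defs
begin

text \<open>
  The group \<open>G\<close> permutes the simplices of \<open>\<Theta>(\<H>)\<close> and preserves their cardinalities. Since
  every orbit of a \<open>p\<close>-group has size a power of \<open>p\<close>, the simplices that \<open>G\<close> moves contribute a
  multiple of \<open>p\<close> to the alternating sum (\<open>p_group_sum_cong_fixed\<close>), and only the simplices
  \<open>\<sigma>\<close> with \<open>g \<sigma> = \<sigma>\<close> for all \<open>g\<close> remain.

  Such a \<open>\<sigma>\<close> is the union of a unique set \<open>T\<close> of vertex orbits (\<open>bij_betw_Union_orbits\<close>),
  and \<open>\<sigma>\<close> avoids a hyperedge \<open>h\<close> exactly if no member of \<open>T\<close> is the orbit of a vertex of
  \<open>h\<close>. Hence the invariant simplices of \<open>\<Theta>(\<H>)\<close> correspond to all the simplices of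
  \<open>\<Theta>(\<H>/G)\<close> (\<open>Theta_quotient_iff\<close>).

  The dimensions of \<open>\<sigma>\<close> and \<open>T\<close> differ, but their signs agree modulo \<open>p\<close>: the cardinality
  of \<open>\<sigma>\<close> is a sum of one power of \<open>p\<close> for each member of \<open>T\<close>, and \<open>(- 1) ^ (p ^ k)\<close> is
  congruent to \<open>- 1\<close>, because \<open>p\<close> is odd or the modulus is \<open>2\<close>
  (\<open>p_group_sign_Union_cong\<close>).
\<close>

section \<open>Signs and Euler characteristics\<close>

lemma minus_one_power_prime_power_cong:
  fixes p :: nat
  assumes "Factorial_Ring.prime p"
  shows "[(- 1 :: int) ^ (p ^ k) = - 1] (mod int p)"
proof (cases "p = 2")
  case True
  show ?thesis
  proof (cases "even (p ^ k)")
    case even: True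
    have "[1 = - 1] (mod (2 :: int))"
      by (simp add: cong_def)
    with even \<open>p = 2\<close> show ?thesis
      by simp
  next
    case False
    then show ?thesis
      by simp
  qed
next
  case False
  with assms have "odd (p ^ k)"
    by (metis even_power primes_dvd_imp_eq two_is_prime_nat)
  then show ?thesis
    by simp
qed

lemma euler_char_eq_minus_sum:
  assumes "\<And>\<sigma>. \<sigma> \<in> K \<Longrightarrow> \<sigma> \<noteq> {} \<and> finite \<sigma>"
  shows "euler_char K = - (\<Sum>\<sigma>\<in>K. (- 1) ^ card \<sigma>)"
proof -
  have "(- 1 :: int) ^ (card \<sigma> - 1) = - ((- 1) ^ card \<sigma>)" if "\<sigma> \<in> K" for \<sigma>
  proof -
    have "card \<sigma> = Suc (card \<sigma> - 1)"
      using assms[OF that] by (simp add: card_gt_0_iff)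
    then have "(- 1 :: int) ^ card \<sigma> = (- 1) * (- 1) ^ (card \<sigma> - 1)"
      by (metis power_Suc)
    then show ?thesis
      by simp
  qed
  then show ?thesis
    by (simp add: euler_char_def sum_negf)
qed

section \<open>Orbits of a \<open>p\<close>-group\<close>

context group_action
begin

lemma orbit_in_orbits: "x \<in> E \<Longrightarrow> orbit G \<phi> x \<in> orbits G E \<phi>"
  by (auto simp: orbits_def)

lemma orbit_eq_of_mem:
  assumes "T \<in> orbits G E \<phi>" "x \<in> T"
  shows "orbit G \<phi> x = T"
proof -
  have "x \<in> E"
    using assms orbits_coverture by blast
  then have "x \<in> orbit G \<phi> x" "orbit G \<phi> x \<in> orbits G E \<phi>"
    by (auto simp: orbit_refl orbits_def)
  with assms disjoint_union show ?thesis
    by blast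
qed

lemma orbits_nonempty: "{} \<notin> orbits G E \<phi>"
  using orbit_refl by (auto simp: orbits_def)

lemma p_group_card_orbit:
  fixes p n :: nat
  assumes "Factorial_Ring.prime p" "order G = p ^ n" "T \<in> orbits G E \<phi>"
  obtains k where "card T = p ^ k"
proof -
  obtain x where "x \<in> E" "T = orbit G \<phi> x"
    using assms(3) by (auto simp: orbits_def)
  then have "card T dvd p ^ n"
    using orbit_stabilizer_theorem[of x] assms(2) by (metis dvd_triv_left)
  with assms(1) that show ?thesis
    by (auto simp: divides_primepow_nat)
qed

text \<open>
  On each orbit \<open>f\<close> is constant, so the orbit contributes a multiple of its cardinality, a power
  of \<open>p\<close>. This power is \<open>1\<close> only for the orbit of a fixed point.
\<close>

lemma p_group_sum_cong_fixed:
  fixes p n :: nat and f :: "'c \<Rightarrow> int"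
  assumes p: "Factorial_Ring.prime p" "order G = p ^ n" and "finite E"
    and inv: "\<And>g x. g \<in> carrier G \<Longrightarrow> x \<in> E \<Longrightarrow> f (\<phi> g x) = f x"
  shows "[sum f E = sum f {x \<in> E. \<forall>g \<in> carrier G. \<phi> g x = x}] (mod int p)"
proof -
  let ?F = "{x \<in> E. \<forall>g \<in> carrier G. \<phi> g x = x}"
  define f' where "f' x = (if x \<in> ?F then 0 else f x)" for x
  have "int p dvd (\<Sum>x\<in>T. f' x)" if T: "T \<in> orbits G E \<phi>" for T
  proof (cases "\<exists>x\<in>T. x \<in> ?F")
    case True
    then obtain x where "x \<in> T" "x \<in> ?F"
      by blast
    then have "T \<subseteq> {x}"
      using orbit_eq_of_mem[OF T] by (auto simp: orbit_def)
    with \<open>x \<in> ?F\<close> have "\<forall>y\<in>T. f' y = 0"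
      by (auto simp: f'_def)
    then show ?thesis
      by simp
  next
    case False
    obtain x where x: "x \<in> E" "T = orbit G \<phi> x"
      using T by (auto simp: orbits_def)
    have "f' y = f x" if "y \<in> T" for y
      using that False x inv by (auto simp: f'_def orbit_def)
    then have sum: "(\<Sum>y\<in>T. f' y) = int (card T) * f x"
      by simp
    have "card T \<noteq> 1"
    proof
      assume "card T = 1"
      then have "T = {x}"
        using x orbit_refl by (metis card_1_singletonE singletonD)
      then have "x \<in> ?F"
        using x by (auto simp: orbit_def)
      with False \<open>T = {x}\<close> show False
        by blast
    qed
    moreover obtain k where "card T = p ^ k"
      using p_group_card_orbit[OF p T] .
    ultimately have "p dvd card T"
      by (cases k) auto
    then show ?thesis
      unfolding sum by simp
  qed
  then have "int p dvd (\<Sum>T\<in>orbits G E \<phi>. \<Sum>x\<in>T. f' x)"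
    by (rule dvd_sum)
  then have "int p dvd sum f' E"
    by (simp add: disjoint_sum[OF \<open>finite E\<close>])
  moreover have "sum f' E = sum f E - sum f ?F"
  proof -
    have "sum f' E = sum f' (E - ?F) + sum f' ?F"
      using \<open>finite E\<close> by (intro sum.subset_diff) auto
    also have "sum f' ?F = 0"
      by (intro sum.neutral) (auto simp: f'_def)
    also have "sum f' (E - ?F) = sum f (E - ?F)"
      by (intro sum.cong) (auto simp: f'_def)
    also have "sum f (E - ?F) + 0 = sum f (E - ?F)"
      by simp
    also have "\<dots> = sum f E - sum f ?F"
      using \<open>finite E\<close> by (intro sum_diff) auto
    finally show ?thesis .
  qed
  ultimately show ?thesis
    by (simp add: cong_iff_dvd_diff)
qed

section \<open>Families of subsets under a group action\<close>

text \<open>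
  The elements of \<^const>\<open>BijGroup\<close> are extensional functions, which is why the image map is
  restricted to the family.
\<close>

lemma image_action:
  assumes sub: "S \<subseteq> Pow E"
    and stable: "\<And>g \<sigma>. g \<in> carrier G \<Longrightarrow> \<sigma> \<in> S \<Longrightarrow> \<phi> g ` \<sigma> \<in> S"
  shows "group_action G S (\<lambda>g. \<lambda>\<sigma>\<in>S. \<phi> g ` \<sigma>)"
proof -
  interpret group G
    using group_hom by (simp add: group_hom_def)
  have comp: "\<phi> (g \<otimes> g') ` \<sigma> = \<phi> g ` \<phi> g' ` \<sigma>"
    if "g \<in> carrier G" "g' \<in> carrier G" "\<sigma> \<in> S" for g g' \<sigma>
    using that sub composition_rule by (force simp: image_image intro!: image_cong)
  have one: "\<phi> \<one> ` \<sigma> = \<sigma>" if "\<sigma> \<in> S" for \<sigma>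
  proof -
    have "\<phi> \<one> x = x" if "x \<in> \<sigma>" for x
      using that \<open>\<sigma> \<in> S\<close> sub by (subst id_eq_one[symmetric]) auto
    then show ?thesis
      by simp
  qed
  have bij: "(\<lambda>\<sigma>\<in>S. \<phi> g ` \<sigma>) \<in> Bij S" if g: "g \<in> carrier G" for g
  proof -
    have "bij_betw (\<lambda>\<sigma>\<in>S. \<phi> g ` \<sigma>) S S"
    proof (rule bij_betw_byWitness[where f' = "\<lambda>\<sigma>\<in>S. \<phi> (inv g) ` \<sigma>"])
      show "\<forall>\<sigma>\<in>S. (\<lambda>\<sigma>\<in>S. \<phi> (inv g) ` \<sigma>) ((\<lambda>\<sigma>\<in>S. \<phi> g ` \<sigma>) \<sigma>) = \<sigma>"
        using g stable one by (simp flip: comp)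
      show "\<forall>\<sigma>\<in>S. (\<lambda>\<sigma>\<in>S. \<phi> g ` \<sigma>) ((\<lambda>\<sigma>\<in>S. \<phi> (inv g) ` \<sigma>) \<sigma>) = \<sigma>"
        using g stable one by (simp flip: comp)
    qed (use g stable in auto)
    then show ?thesis
      by (simp add: Bij_def)
  qed
  have "(\<lambda>g. \<lambda>\<sigma>\<in>S. \<phi> g ` \<sigma>) \<in> hom G (BijGroup S)"
  proof (rule homI)
    fix g g' assume g: "g \<in> carrier G" "g' \<in> carrier G"
    show "(\<lambda>\<sigma>\<in>S. \<phi> (g \<otimes> g') ` \<sigma>) =
        (\<lambda>\<sigma>\<in>S. \<phi> g ` \<sigma>) \<otimes>\<^bsub>BijGroup S\<^esub> (\<lambda>\<sigma>\<in>S. \<phi> g' ` \<sigma>)"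
      using g by (intro ext) (simp add: BijGroup_def bij compose_def comp stable)
  qed (simp add: BijGroup_def bij)
  then show ?thesis
    by (simp add: group_action_def group_hom_def group_hom_axioms_def group_BijGroup is_group)
qed

text \<open>
  The inverse sends an invariant set to the set of orbits of its points; invariance ensures that
  these orbits do not leave the set.
\<close>

lemma bij_betw_Union_orbits:
  "bij_betw Union (Pow (orbits G E \<phi>)) {\<sigma>. \<sigma> \<subseteq> E \<and> (\<forall>g \<in> carrier G. \<phi> g ` \<sigma> = \<sigma>)}"
proof (rule bij_betw_byWitness[where f' = "\<lambda>\<sigma>. orbit G \<phi> ` \<sigma>"])
  interpret group G
    using group_hom by (simp add: group_hom_def)
  show "\<forall>\<T>\<in>Pow (orbits G E \<phi>). orbit G \<phi> ` \<Union>\<T> = \<T>"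
  proof
    fix \<T> assume \<T>: "\<T> \<in> Pow (orbits G E \<phi>)"
    have "T \<in> orbit G \<phi> ` \<Union>\<T>" if "T \<in> \<T>" for T
    proof -
      have "T \<noteq> {}"
        using that \<T> orbits_nonempty by auto
      then obtain x where "x \<in> T"
        by blast
      then have "orbit G \<phi> x = T"
        using that \<T> orbit_eq_of_mem by blast
      with that \<open>x \<in> T\<close> show ?thesis
        by blast
    qed
    moreover have "orbit G \<phi> x \<in> \<T>" if "x \<in> T" "T \<in> \<T>" for x T
    proof -
      have "orbit G \<phi> x = T"
        using that \<T> orbit_eq_of_mem by blast
      with that show ?thesis
        by simp
    qed
    ultimately show "orbit G \<phi> ` \<Union>\<T> = \<T>"
      by blast
  qed
  show "\<forall>\<sigma>\<in>{\<sigma>. \<sigma> \<subseteq> E \<and> (\<forall>g \<in> carrier G. \<phi> g ` \<sigma> = \<sigma>)}. \<Union> (orbit G \<phi> ` \<sigma>) = \<sigma>"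
  proof safe
    fix \<sigma> x y
    assume "\<forall>g \<in> carrier G. \<phi> g ` \<sigma> = \<sigma>" "x \<in> \<sigma>" "y \<in> orbit G \<phi> x"
    then show "y \<in> \<sigma>"
      by (auto simp: orbit_def)
  next
    fix \<sigma> x
    assume "\<sigma> \<subseteq> E" "x \<in> \<sigma>"
    then show "x \<in> \<Union> (orbit G \<phi> ` \<sigma>)"
      using orbit_refl by blast
  qed
  show "Union ` Pow (orbits G E \<phi>) \<subseteq> {\<sigma>. \<sigma> \<subseteq> E \<and> (\<forall>g \<in> carrier G. \<phi> g ` \<sigma> = \<sigma>)}"
  proof safe
    fix \<T> T x assume "\<T> \<subseteq> orbits G E \<phi>" "T \<in> \<T>" "x \<in> T"
    then show "x \<in> E"
      using orbits_coverture by blast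
  next
    fix \<T> T g x
    assume \<T>: "\<T> \<subseteq> orbits G E \<phi>" and g: "g \<in> carrier G" and x: "T \<in> \<T>" "x \<in> T"
    have T: "orbit G \<phi> x = T"
      using \<T> x orbit_eq_of_mem by blast
    have "\<phi> h x \<in> T" if "h \<in> carrier G" for h
      using that T by (auto simp: orbit_def)
    with g x show "\<phi> g x \<in> \<Union>\<T>"
      by blast
    have "x \<in> E"
      using \<T> x orbits_coverture by blast
    then have "x = \<phi> g (\<phi> (inv g) x)"
      using g orbit_sym_aux[of "inv g" x] by simp
    moreover have "\<phi> (inv g) x \<in> \<Union>\<T>"
      using \<open>\<And>h. h \<in> carrier G \<Longrightarrow> \<phi> h x \<in> T\<close> g x by blast
    ultimately show "x \<in> \<phi> g ` \<Union>\<T>"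
      by blast
  qed
  show "(\<lambda>\<sigma>. orbit G \<phi> ` \<sigma>) ` {\<sigma>. \<sigma> \<subseteq> E \<and> (\<forall>g \<in> carrier G. \<phi> g ` \<sigma> = \<sigma>)}
      \<subseteq> Pow (orbits G E \<phi>)"
    using orbit_in_orbits by blast
qed

text \<open>
  The left-hand side is a product over the orbits in \<open>\<T>\<close> of factors \<open>(- 1) ^ (p ^ k)\<close>, each
  congruent to \<open>- 1\<close>.
\<close>

lemma p_group_sign_Union_cong:
  fixes p n :: nat
  assumes p: "Factorial_Ring.prime p" "order G = p ^ n" and "finite E"
    and \<T>: "\<T> \<subseteq> orbits G E \<phi>"
  shows "[(- 1 :: int) ^ card (\<Union>\<T>) = (- 1) ^ card \<T>] (mod int p)"
proof -
  have "card (\<Union>\<T>) = (\<Sum>T\<in>\<T>. card T)"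
  proof (rule card_Union_disjoint)
    show "pairwise disjnt \<T>"
    proof (rule pairwiseI)
      fix S T assume "S \<in> \<T>" "T \<in> \<T>" "S \<noteq> T"
      then show "disjnt S T"
        using disjoint_union[of S T] \<T> by (auto simp: disjnt_def)
    qed
    show "finite T" if "T \<in> \<T>" for T
    proof -
      have "T \<subseteq> E"
        using that \<T> orbits_coverture by blast
      then show ?thesis
        using \<open>finite E\<close> by (rule finite_subset)
    qed
  qed
  then have "(- 1 :: int) ^ card (\<Union>\<T>) = (\<Prod>T\<in>\<T>. (- 1) ^ card T)"
    by (simp add: power_sum)
  also have "[\<dots> = (\<Prod>T\<in>\<T>. - 1)] (mod int p)"
  proof (rule cong_prod)
    fix T assume "T \<in> \<T>"
    then obtain k where "card T = p ^ k"
      using p_group_card_orbit[OF p] \<T> by blast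
    then show "[(- 1 :: int) ^ card T = - 1] (mod int p)"
      by (simp add: minus_one_power_prime_power_cong[OF p(1)])
  qed
  finally show ?thesis
    by simp
qed

end

section \<open>Simplices of the quotient hypergraph\<close>

context hypergraph_action
begin

lemma Theta_image:
  assumes g: "g \<in> carrier G" and "\<sigma> \<in> Theta X"
  shows "\<phi> g ` \<sigma> \<in> Theta X"
proof -
  obtain h where h: "h \<in> hyperedges X" and \<sigma>: "\<sigma> \<subseteq> verts X - h" "\<sigma> \<noteq> {}" "finite \<sigma>"
    using assms by (auto simp: Theta_def)
  \<comment> \<open>As \<open>\<phi> g\<close> is injective on the vertices, disjointness from \<open>h\<close> is carried to disjointness
    from its image.\<close>
  have "\<phi> g ` \<sigma> \<subseteq> verts X - \<phi> g ` h"
  proof -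
    have "\<phi> g ` \<sigma> \<inter> \<phi> g ` h = {}"
      using inj_prop[OF g] \<sigma> hyperedge_subset[OF h]
      by (subst inj_on_image_Int[symmetric, of _ "verts X"]) auto
    moreover have "\<phi> g ` \<sigma> \<subseteq> verts X"
      using \<sigma> surj_prop[OF g] by blast
    ultimately show ?thesis
      by blast
  qed
  with \<sigma> hyperedge_image[OF g h] show ?thesis
    by (auto simp: Theta_def)
qed

text \<open>
  The union of \<open>\<T>\<close> meets a hyperedge \<open>h\<close> exactly if the orbit of some point of \<open>h\<close> belongs to
  \<open>\<T>\<close>, that is, if \<open>\<T>\<close> meets the image of \<open>h\<close> in the quotient.
\<close>

lemma Theta_quotient_iff:
  assumes "finite (verts X)" and \<T>: "\<T> \<subseteq> orbits G (verts X) \<phi>"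
  shows "\<T> \<in> Theta (quotient_hypergraph X G \<phi>) \<longleftrightarrow> \<Union>\<T> \<in> Theta X"
proof -
  have union: "\<Union>\<T> \<subseteq> verts X"
    using \<T> orbits_coverture by blast
  have "finite (orbits G (verts X) \<phi>)"
    using assms(1) by (simp add: orbits_def setcompr_eq_image)
  then have fin: "finite \<T>" "finite (\<Union>\<T>)"
    using \<T> union assms(1) by (auto intro: finite_subset)
  have nonempty: "\<T> = {} \<longleftrightarrow> \<Union>\<T> = {}"
    using \<T> orbits_nonempty by auto
  have avoid: "\<T> \<subseteq> orbits G (verts X) \<phi> - orbit G \<phi> ` h \<longleftrightarrow> \<Union>\<T> \<subseteq> verts X - h"
    if "h \<in> hyperedges X" for h
  proof -
    have "orbit G \<phi> x \<in> \<T> \<longleftrightarrow> x \<in> \<Union>\<T>" if "x \<in> h" for x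
    proof
      assume "orbit G \<phi> x \<in> \<T>"
      moreover have "x \<in> orbit G \<phi> x"
        using that \<open>h \<in> hyperedges X\<close> hyperedge_subset by (blast intro: orbit_refl)
      ultimately show "x \<in> \<Union>\<T>"
        by blast
    next
      assume "x \<in> \<Union>\<T>"
      then obtain T where "T \<in> \<T>" "x \<in> T"
        by blast
      then have "orbit G \<phi> x = T"
        using \<T> orbit_eq_of_mem by blast
      with \<open>T \<in> \<T>\<close> show "orbit G \<phi> x \<in> \<T>"
        by simp
    qed
    then have "\<T> \<inter> orbit G \<phi> ` h = {} \<longleftrightarrow> \<Union>\<T> \<inter> h = {}"
      by blast
    moreover have "\<T> \<subseteq> orbits G (verts X) \<phi> - orbit G \<phi> ` h \<longleftrightarrow> \<T> \<inter> orbit G \<phi> ` h = {}"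
      using \<T> by (simp add: Diff_eq disjoint_eq_subset_Compl)
    moreover have "\<Union>\<T> \<subseteq> verts X - h \<longleftrightarrow> \<Union>\<T> \<inter> h = {}"
      using union by (simp only: Diff_eq disjoint_eq_subset_Compl le_inf_iff simp_thms)
    ultimately show ?thesis
      by (simp only:)
  qed
  show ?thesis
    using fin nonempty avoid by (simp add: Theta_def quotient_hypergraph_def)
qed

lemma bij_betw_Theta_quotient:
  assumes "finite (verts X)"
  shows "bij_betw Union (Theta (quotient_hypergraph X G \<phi>))
    {\<sigma> \<in> Theta X. \<forall>g \<in> carrier G. \<phi> g ` \<sigma> = \<sigma>}"
proof -
  let ?orbs = "orbits G (verts X) \<phi>"
  let ?inv = "{\<sigma>. \<sigma> \<subseteq> verts X \<and> (\<forall>g \<in> carrier G. \<phi> g ` \<sigma> = \<sigma>)}"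
  have "Theta (quotient_hypergraph X G \<phi>) \<subseteq> Pow ?orbs"
    by (auto simp: Theta_def quotient_hypergraph_def)
  then have dom: "Theta (quotient_hypergraph X G \<phi>) = {\<T> \<in> Pow ?orbs. \<Union>\<T> \<in> Theta X}"
    using Theta_quotient_iff[OF assms] by auto
  have "{\<sigma> \<in> Theta X. \<forall>g \<in> carrier G. \<phi> g ` \<sigma> = \<sigma>} = {\<sigma> \<in> ?inv. \<sigma> \<in> Theta X}"
    by (auto simp: Theta_def)
  also have "\<dots> = Union ` {\<T> \<in> Pow ?orbs. \<Union>\<T> \<in> Theta X}"
    by (subst bij_betw_imp_surj_on[OF bij_betw_Union_orbits, symmetric]) auto
  finally show ?thesis
    unfolding dom by (intro bij_betw_subset[OF bij_betw_Union_orbits]) auto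
qed

end

theorem theorem8:
  fixes X :: "'v pre_hypergraph"
    and G :: "('g, 'r) monoid_scheme"
    and \<phi> :: "'g \<Rightarrow> 'v \<Rightarrow> 'v"
    and p n :: nat
  assumes "Factorial_Ring.prime p"
    and "finite (verts X)"
    and "order G = p ^ n"
    and "hypergraph_action X G \<phi>"
  shows "[euler_char (Theta X) = euler_char (Theta (quotient_hypergraph X G \<phi>))] (mod int p)"
proof -
  interpret hypergraph_action X G \<phi>
    by fact
  let ?\<psi> = "\<lambda>g. \<lambda>\<sigma>\<in>Theta X. \<phi> g ` \<sigma>"
  let ?Q = "Theta (quotient_hypergraph X G \<phi>)"
  interpret simplices: group_action G "Theta X" ?\<psi>
  proof (rule image_action)
    show "Theta X \<subseteq> Pow (verts X)"
      by (auto simp: Theta_def)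
  qed (rule Theta_image)
  have "(- 1 :: int) ^ card (?\<psi> g \<sigma>) = (- 1) ^ card \<sigma>"
    if "g \<in> carrier G" "\<sigma> \<in> Theta X" for g \<sigma>
  proof -
    have "inj_on (\<phi> g) \<sigma>"
      using that by (auto simp: Theta_def intro: inj_on_subset[OF inj_prop])
    with that show ?thesis
      by (simp add: card_image)
  qed
  from simplices.p_group_sum_cong_fixed[OF assms(1,3) finite_Theta[OF assms(2)] this]
  have "[(\<Sum>\<sigma>\<in>Theta X. (- 1 :: int) ^ card \<sigma>) =
      (\<Sum>\<sigma>\<in>{\<sigma> \<in> Theta X. \<forall>g \<in> carrier G. ?\<psi> g \<sigma> = \<sigma>}. (- 1) ^ card \<sigma>)] (mod int p)"
    by blast
  also have "{\<sigma> \<in> Theta X. \<forall>g \<in> carrier G. ?\<psi> g \<sigma> = \<sigma>} =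
      {\<sigma> \<in> Theta X. \<forall>g \<in> carrier G. \<phi> g ` \<sigma> = \<sigma>}"
    by auto
  also have "(\<Sum>\<sigma>\<in>\<dots>. (- 1 :: int) ^ card \<sigma>) = (\<Sum>\<T>\<in>?Q. (- 1) ^ card (\<Union>\<T>))"
    by (rule sum.reindex_bij_betw[OF bij_betw_Theta_quotient[OF assms(2)], symmetric])
  also have "[\<dots> = (\<Sum>\<T>\<in>?Q. (- 1) ^ card \<T>)] (mod int p)"
  proof (rule cong_sum)
    fix \<T> assume "\<T> \<in> ?Q"
    then have "\<T> \<subseteq> orbits G (verts X) \<phi>"
      by (auto simp: Theta_def quotient_hypergraph_def)
    then show "[(- 1 :: int) ^ card (\<Union>\<T>) = (- 1) ^ card \<T>] (mod int p)"
      by (rule p_group_sign_Union_cong[OF assms(1,3,2)])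
  qed
  finally show ?thesis
    by (subst (1 2) euler_char_eq_minus_sum) (auto simp: Theta_def cong_minus_minus_iff)
qed

end
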